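(* (Union Lemma) Let $\kappa$ be a singular cardinal of countable cofinality and let $(A^m_n)_{n<\omega}$, $m<\omega$, be chain models of a fixed vocabulary. If $(A^m_n)_{n<\omega}\prec_{L^c_{\kappa,\kappa}}(A^{m+1}_n)_{n<\omega}$ for all $m<\omega$, then $(A^m_n)_{n<\omega}\prec_{L^c_{\kappa,\kappa}}(A^\omega_n)_{n<\omega}$ for all $m<\omega$, where $(A^\omega_n)_{n<\omega}$ is the union of the sequence of chain models $\langle(A^m_n)_{n<\omega}:m<\omega\rangle$.
   Context: A (weak) chain model $(A_n)_{n<\omega}$ is a structure with universe $A$ (in a relational vocabulary) together with sets $A_n\subseteq A_{n+1}$ ($n<\omega$) such that $A=\bigcup_nA_n$. A sequence of length $<\kappa$ is bounded in $(A_n)_n$ if it is contained in some $A_n$. $L_{\kappa,\kappa}$ is formed like first order logic but allowing conjunctions and disjunctions of length $<\kappa$ and strings of $<\kappa$ quantifiers. The relation $\models^c$ is defined by induction as usual for quantifier-free formulas and connectives, and $(A_n)_n\models^c\exists\bar x\,\varphi(\bar x)$ iff there are $n<\omega$ and a sequence $\bar a$ of elements of $A_n$, of the same length ($<\kappa$) as $\bar x$, with $(A_n)_n\models^c\varphi[\bar a]$. Formulas of $L^c_{\kappa,\kappa}$ are formulas of $L_{\kappa,\kappa}$ interpreted by $\models^c$. $(A_n)_{n<\omega}\subseteq(B_n)_{n<\omega}$ means that $\bigcup_nA_n\subseteq\bigcup_nB_n$ (as structures) and for all $n$ there is $m$ with $A_n\subseteq B_m$. $(A_n)_{n<\omega}\prec_{L^c_{\kappa,\kappa}}(B_n)_{n<\omega}$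 means that $(A_n)_{n<\omega}\subseteq(B_n)_{n<\omega}$ and for every bounded sequence $\bar a$ in $(A_n)_{n<\omega}$ and formula $\phi(\bar x)$ of $L^c_{\kappa,\kappa}$, $(A_n)_{n<\omega}\models^c\phi(\bar a)$ iff $(B_n)_{n<\omega}\models^c\phi(\bar a)$. If $(A^m_n)_{n<\omega}\subseteq(A^{m+1}_n)_{n<\omega}$ for all $m$, the union of the sequence is the chain model $(A^\omega_n)_{n<\omega}$ with $A^\omega_n=\bigcup_{m\le n}A^m_n$ (whose underlying structure is the union of the underlying structures). *)

theory Defs
  imports Main
begin

unbundle cardinal_syntax

text \<open>
  A cardinal is a cardinal order \<open>\<kappa>\<close> on some type; \<open>|X| <o \<kappa>\<close> says that \<open>X\<close> has fewer than
  \<open>\<kappa>\<close> elements. The library's \<open>cofinal\<close> asks for strict upper bounds, which makes no difference for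
  infinite cardinals.
\<close>

definition has_cofinality :: "'k rel \<Rightarrow> 'l rel \<Rightarrow> bool" where
  "has_cofinality \<kappa> \<mu> \<longleftrightarrow>
     (\<exists>K. K \<subseteq> Field \<kappa> \<and> cofinal K \<kappa> \<and> |K| =o \<mu>) \<and>
     (\<forall>K. K \<subseteq> Field \<kappa> \<and> cofinal K \<kappa> \<longrightarrow> \<mu> \<le>o |K| )"

definition singular_card :: "'k rel \<Rightarrow> bool" where
  "singular_card \<kappa> \<longleftrightarrow> Card_order \<kappa> \<and> \<not> finite (Field \<kappa>) \<and> \<not> regularCard \<kappa>"

text \<open>
  A relational vocabulary is a partial map \<open>voc\<close> sending each of its relation symbols to its
  (finite) arity. Values of \<open>interp\<close> at symbols outside the vocabulary are irrelevant.
\<close>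

record ('a, 'r) struct =
  carrier :: "'a set"
  interp :: "'r \<Rightarrow> 'a list set"

record ('a, 'r) chain_model = "('a, 'r) struct" +
  level :: "nat \<Rightarrow> 'a set"

definition is_struct :: "('r \<rightharpoonup> nat) \<Rightarrow> ('a, 'r, 'z) struct_scheme \<Rightarrow> bool" where
  "is_struct voc M \<longleftrightarrow>
     (\<forall>R n. voc R = Some n \<longrightarrow> interp M R \<subseteq> {as. length as = n \<and> set as \<subseteq> carrier M})"

definition is_chain_model :: "('r \<rightharpoonup> nat) \<Rightarrow> ('a, 'r) chain_model \<Rightarrow> bool" where
  "is_chain_model voc M \<longleftrightarrow>
     is_struct voc M \<and> (\<forall>n. level M n \<subseteq> level M (Suc n)) \<and> carrier M = (\<Union>n. level M n)"

definition substruct ::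
  "('r \<rightharpoonup> nat) \<Rightarrow> ('a, 'r, 'y) struct_scheme \<Rightarrow> ('a, 'r, 'z) struct_scheme \<Rightarrow> bool" where
  "substruct voc M N \<longleftrightarrow>
     carrier M \<subseteq> carrier N \<and>
     (\<forall>R \<in> dom voc. interp M R = {as \<in> interp N R. set as \<subseteq> carrier M})"

definition chain_sub ::
  "('r \<rightharpoonup> nat) \<Rightarrow> ('a, 'r) chain_model \<Rightarrow> ('a, 'r) chain_model \<Rightarrow> bool" where
  "chain_sub voc M N \<longleftrightarrow> substruct voc M N \<and> (\<forall>n. \<exists>m. level M n \<subseteq> level N m)"

definition chain_union :: "(nat \<Rightarrow> ('a, 'r) chain_model) \<Rightarrow> ('a, 'r) chain_model" where
  "chain_union A =
     \<lparr>carrier = (\<Union>m. carrier (A m)),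
      interp = (\<lambda>R. \<Union>m. interp (A m) R),
      level = (\<lambda>n. \<Union>m\<le>n. level (A m) n)\<rparr>"

text \<open>
  Elements of \<open>'k\<close> serve both as variables and as indices of conjunctions and disjunctions;
  a cardinal \<open>\<kappa>\<close> living on \<open>'k\<close> guarantees that there are enough of either. In \<open>Conj I f\<close> and
  \<open>Disj I f\<close> only the values of \<open>f\<close> on \<open>I\<close> matter. \<open>Exists V \<phi>\<close> quantifies simultaneously over all
  variables in \<open>V\<close>; the universal quantifier is its dual \<open>Forall\<close>.
\<close>

datatype ('k, 'r) fm =
    Eq 'k 'k
  | Rel 'r "'k list"
  | Neg "('k, 'r) fm"
  | Conj "'k set" "'k \<Rightarrow> ('k, 'r) fm"
  | Disj "'k set" "'k \<Rightarrow> ('k, 'r) fm"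
  | Exists "'k set" "('k, 'r) fm"

definition Forall :: "'k set \<Rightarrow> ('k, 'r) fm \<Rightarrow> ('k, 'r) fm" where
  "Forall V \<phi> = Neg (Exists V (Neg \<phi>))"

primrec is_formula :: "'k rel \<Rightarrow> ('r \<rightharpoonup> nat) \<Rightarrow> ('k, 'r) fm \<Rightarrow> bool" where
  "is_formula \<kappa> voc (Eq x y) \<longleftrightarrow> True"
| "is_formula \<kappa> voc (Rel R xs) \<longleftrightarrow> voc R = Some (length xs)"
| "is_formula \<kappa> voc (Neg \<phi>) \<longleftrightarrow> is_formula \<kappa> voc \<phi>"
| "is_formula \<kappa> voc (Conj I f) \<longleftrightarrow> |I| <o \<kappa> \<and> (\<forall>i\<in>I. is_formula \<kappa> voc (f i))"
| "is_formula \<kappa> voc (Disj I f) \<longleftrightarrow> |I| <o \<kappa> \<and> (\<forall>i\<in>I. is_formula \<kappa> voc (f i))"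
| "is_formula \<kappa> voc (Exists V \<phi>) \<longleftrightarrow> |V| <o \<kappa> \<and> is_formula \<kappa> voc \<phi>"

primrec free_vars :: "('k, 'r) fm \<Rightarrow> 'k set" where
  "free_vars (Eq x y) = {x, y}"
| "free_vars (Rel R xs) = set xs"
| "free_vars (Neg \<phi>) = free_vars \<phi>"
| "free_vars (Conj I f) = (\<Union>i\<in>I. free_vars (f i))"
| "free_vars (Disj I f) = (\<Union>i\<in>I. free_vars (f i))"
| "free_vars (Exists V \<phi>) = free_vars \<phi> - V"

primrec csat :: "('a, 'r) chain_model \<Rightarrow> ('k, 'r) fm \<Rightarrow> ('k \<Rightarrow> 'a) \<Rightarrow> bool" where
  "csat M (Eq x y) s \<longleftrightarrow> s x = s y"
| "csat M (Rel R xs) s \<longleftrightarrow> map s xs \<in> interp M R"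
| "csat M (Neg \<phi>) s \<longleftrightarrow> \<not> csat M \<phi> s"
| "csat M (Conj I f) s \<longleftrightarrow> (\<forall>i\<in>I. csat M (f i) s)"
| "csat M (Disj I f) s \<longleftrightarrow> (\<exists>i\<in>I. csat M (f i) s)"
| "csat M (Exists V \<phi>) s \<longleftrightarrow>
     (\<exists>n a. a ` V \<subseteq> level M n \<and> csat M \<phi> (override_on s a V))"

text \<open>
  A set \<open>X\<close> of fewer than \<open>\<kappa>\<close> variables plays the role of \<open>x\<close> in \<open>\<phi>(x)\<close>, and the restriction of
  the assignment \<open>s\<close> to \<open>X\<close> that of the sequence substituted for it. For singular \<open>\<kappa>\<close> a formula
  in the sense of \<open>is_formula\<close> may have \<open>\<kappa>\<close> free variables; such formulas are excluded here, and
  all subformulas of a formula with fewer than \<open>\<kappa>\<close> free variables again have fewer than \<open>\<kappa>\<close>.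
\<close>

definition chain_elem_sub ::
  "'k rel \<Rightarrow> ('r \<rightharpoonup> nat) \<Rightarrow> ('a, 'r) chain_model \<Rightarrow> ('a, 'r) chain_model \<Rightarrow> bool" where
  "chain_elem_sub \<kappa> voc M N \<longleftrightarrow>
     chain_sub voc M N \<and>
     (\<forall>X s \<phi>. |X| <o \<kappa> \<and> (\<exists>n. s ` X \<subseteq> level M n) \<and> is_formula \<kappa> voc \<phi> \<and> free_vars \<phi> \<subseteq> X \<longrightarrow>
        (csat M \<phi> s \<longleftrightarrow> csat N \<phi> s))"

lemma is_chain_model_chain_union:
  assumes cm: "\<And>m. is_chain_model voc (A m)"
  shows "is_chain_model voc (chain_union A)"
proof -
  have mono: "level (A m) i \<subseteq> level (A m) j" if "i \<le> j" for m i j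
    using lift_Suc_mono_le[of "level (A m)" i j] cm that by (auto simp: is_chain_model_def)
  have "(\<Union>m. carrier (A m)) \<subseteq> (\<Union>n. \<Union>m\<le>n. level (A m) n)"
  proof
    fix x assume "x \<in> (\<Union>m. carrier (A m))"
    then obtain m n where "x \<in> level (A m) n"
      using cm by (auto simp: is_chain_model_def)
    then have "x \<in> level (A m) (max m n)"
      using mono[of n "max m n" m] by auto
    then show "x \<in> (\<Union>n. \<Union>m\<le>n. level (A m) n)"
      by (auto intro!: exI[of _ "max m n"] bexI[of _ m])
  qed
  moreover have "(\<Union>n. \<Union>m\<le>n. level (A m) n) \<subseteq> (\<Union>m. carrier (A m))"
    using cm by (auto simp: is_chain_model_def)
  moreover have "(\<Union>m\<le>n. level (A m) n) \<subseteq> (\<Union>m\<le>Suc n. level (A m) (Suc n))" for n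
    using mono[of n "Suc n"] by fastforce
  moreover have "is_struct voc (chain_union A)"
    using cm by (fastforce simp: is_chain_model_def is_struct_def chain_union_def)
  ultimately show ?thesis
    by (auto simp: is_chain_model_def chain_union_def)
qed

end

theory Submission
  imports Defs
begin

text \<open>
  The proof is Tarski's elementary chain argument, by induction on the formula and simultaneously
  for all stages \<open>A m\<close>. As usual, only the step from the union down to a stage, for
  an existential quantifier, needs an idea. The witnesses found in the union may be infinitely
  many, and in an arbitrary union of models they could be spread cofinally over the stages. Bounded
  satisfaction prevents this: the witnesses lie in one level \<open>n\<close> of the union, which is a finite
  union of levels of the stages up to \<open>n\<close>, and therefore is contained in a single level of any
  stage \<open>A k\<close> with \<open>k \<ge> n\<close> (lemma \<open>union_level_bounded_in_stage\<close>). If moreover \<open>k \<ge> m\<close>, the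
  parameters are bounded in \<open>A k\<close> as well, so the induction hypothesis applies at
  stage \<open>k\<close>, and \<open>A m \<prec> A k\<close> (lemma \<open>chain_elem_sub_le\<close>) brings the existential formula back to
  stage \<open>m\<close>. Since \<open>\<kappa>\<close> is an infinite cardinal, adding the bound variables of a quantifier to
  the parameters keeps their number below \<open>\<kappa>\<close>.
\<close>

lemma level_mono:
  assumes "is_chain_model voc M" "i \<le> j"
  shows "level M i \<subseteq> level M j"
  using assms lift_Suc_mono_le[of "level M" i j] by (auto simp: is_chain_model_def)

lemma level_subset_carrier: "is_chain_model voc M \<Longrightarrow> level M n \<subseteq> carrier M"
  by (auto simp: is_chain_model_def)

lemma chain_sub_refl:
  assumes "is_chain_model voc M"
  shows "chain_sub voc M M"
  using assms by (fastforce simp: chain_sub_def substruct_def is_chain_model_def is_struct_def)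

lemma chain_sub_trans:
  assumes "chain_sub voc M N" "chain_sub voc N P"
  shows "chain_sub voc M P"
  unfolding chain_sub_def substruct_def
proof (intro conjI ballI allI)
  show "carrier M \<subseteq> carrier P"
    using assms by (auto simp: chain_sub_def substruct_def)
  show "interp M R = {as \<in> interp P R. set as \<subseteq> carrier M}" if "R \<in> dom voc" for R
    using assms that unfolding chain_sub_def substruct_def by blast
  fix n
  obtain l where "level M n \<subseteq> level N l"
    using assms(1) unfolding chain_sub_def by blast
  moreover obtain k where "level N l \<subseteq> level P k"
    using assms(2) unfolding chain_sub_def by blast
  ultimately show "\<exists>k. level M n \<subseteq> level P k"
    by blast
qed

lemma chain_elem_sub_refl: "is_chain_model voc M \<Longrightarrow> chain_elem_sub \<kappa> voc M M"
  by (simp add: chain_elem_sub_def chain_sub_refl)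

lemma chain_elem_sub_trans:
  assumes MN: "chain_elem_sub \<kappa> voc M N" and NP: "chain_elem_sub \<kappa> voc N P"
  shows "chain_elem_sub \<kappa> voc M P"
proof -
  have "csat M \<phi> s \<longleftrightarrow> csat P \<phi> s"
    if "|X| <o \<kappa>" "s ` X \<subseteq> level M n" "is_formula \<kappa> voc \<phi>" "free_vars \<phi> \<subseteq> X" for X s \<phi> n
  proof -
    obtain l where "level M n \<subseteq> level N l"
      using MN unfolding chain_elem_sub_def chain_sub_def by blast
    with that have "s ` X \<subseteq> level N l"
      by blast
    with that MN NP show ?thesis
      unfolding chain_elem_sub_def by blast
  qed
  with chain_sub_trans[of voc M N P] MN NP show ?thesis
    unfolding chain_elem_sub_def by blast
qed

lemma chain_elem_sub_le:
  assumes "\<And>m. is_chain_model voc (A m)"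
    and "\<And>m. chain_elem_sub \<kappa> voc (A m) (A (Suc m))"
    and "m \<le> k"
  shows "chain_elem_sub \<kappa> voc (A m) (A k)"
  using \<open>m \<le> k\<close>
proof (induction k rule: dec_induct)
  case base
  then show ?case using assms(1) by (rule chain_elem_sub_refl)
next
  case (step k)
  then show ?case using assms(2) by (blast intro: chain_elem_sub_trans)
qed

lemma chain_sub_chain_union:
  assumes cm: "\<And>m. is_chain_model voc (A m)"
    and sub: "\<And>m k. m \<le> k \<Longrightarrow> chain_sub voc (A m) (A k)"
  shows "chain_sub voc (A m) (chain_union A)"
proof -
  have interp_sub: "interp (A i) R = {as \<in> interp (A k) R. set as \<subseteq> carrier (A i)}"
    if "i \<le> k" "R \<in> dom voc" for i k R
    using sub[OF that(1)] that(2) unfolding chain_sub_def substruct_def by blast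
  have "interp (A m) R = {as \<in> \<Union>k. interp (A k) R. set as \<subseteq> carrier (A m)}"
    if R: "R \<in> dom voc" for R
  proof -
    have "as \<in> interp (A m) R" if "as \<in> interp (A k) R" "set as \<subseteq> carrier (A m)" for as k
    proof (cases "m \<le> k")
      case True
      with interp_sub[OF _ R, of m k] that show ?thesis
        by blast
    next
      case False
      with interp_sub[OF _ R, of k m] that show ?thesis
        by auto
    qed
    moreover have "set as \<subseteq> carrier (A m)" if "as \<in> interp (A m) R" for as
      using interp_sub[OF order_refl R, of m] that by blast
    ultimately show ?thesis
      by blast
  qed
  then have "substruct voc (A m) (chain_union A)"
    by (auto simp: substruct_def chain_union_def)
  moreover have "level (A m) n \<subseteq> level (chain_union A) (max m n)" for n
    using level_mono[OF cm, of n "max m n" m]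
    by (auto simp: chain_union_def intro!: bexI[of _ m])
  ultimately show ?thesis
    unfolding chain_sub_def by blast
qed

text \<open>
  Only finitely many stages contribute to a level of the union. Each contribution is bounded in a
  later stage \<open>A k\<close>, and the maximum of finitely many bounds serves for all of them. This is what
  replaces the finiteness of quantifier strings in the elementary chain theorem of first-order logic.
\<close>
lemma union_level_bounded_in_stage:
  assumes cm: "\<And>m. is_chain_model voc (A m)"
    and sub: "\<And>m k. m \<le> k \<Longrightarrow> chain_sub voc (A m) (A k)"
    and "n \<le> k"
  shows "\<exists>N. level (chain_union A) n \<subseteq> level (A k) N"
proof -
  have "\<exists>b. level (A i) n \<subseteq> level (A k) b" if "i \<le> n" for i
    using sub[of i k] that \<open>n \<le> k\<close> by (auto simp: chain_sub_def)
  then obtain b where b: "level (A i) n \<subseteq> level (A k) (b i)" if "i \<le> n" for i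
    by metis
  have "level (A i) n \<subseteq> level (A k) (Max (b ` {..n}))" if "i \<le> n" for i
    using b[OF that] level_mono[OF cm, of "b i" "Max (b ` {..n})" k] that by auto
  then show ?thesis
    by (auto simp: chain_union_def)
qed

text \<open>
  The stage \<open>m\<close> and the set \<open>X\<close> of parameter variables vary in the induction: at a quantifier
  the bound variables join the parameters, and the induction hypothesis for the matrix may be
  needed at a stage later than \<open>m\<close>.
\<close>
lemma csat_chain_union_iff:
  fixes \<kappa> :: "'k rel"
  assumes "Card_order \<kappa>" "infinite (Field \<kappa>)"
    and cm: "\<And>m. is_chain_model voc (A m)"
    and elem: "\<And>m k. m \<le> k \<Longrightarrow> chain_elem_sub \<kappa> voc (A m) (A k)"
    and "|X| <o \<kappa>" "s ` X \<subseteq> level (A m) n" "is_formula \<kappa> voc \<phi>" "free_vars \<phi> \<subseteq> X"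
  shows "csat (A m) \<phi> s \<longleftrightarrow> csat (chain_union A) \<phi> s"
  using assms(5-)
proof (induction \<phi> arbitrary: m n X s)
  case (Rel R xs)
  have "chain_sub voc (A m) (chain_union A)"
    using chain_sub_chain_union[of voc A] cm elem by (auto simp: chain_elem_sub_def)
  moreover have "set (map s xs) \<subseteq> carrier (A m)"
    using Rel.prems level_subset_carrier[OF cm] by fastforce
  moreover have "R \<in> dom voc"
    using Rel.prems by auto
  ultimately show ?case
    unfolding chain_sub_def substruct_def by auto
next
  case (Neg \<phi>)
  then show ?case by simp
next
  case (Conj I f)
  have "csat (A m) (f i) s \<longleftrightarrow> csat (chain_union A) (f i) s" if "i \<in> I" for i
    using Conj.prems that by (intro Conj.IH[of _ X _ _ n]) auto
  then show ?case by simp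
next
  case (Disj I f)
  have "csat (A m) (f i) s \<longleftrightarrow> csat (chain_union A) (f i) s" if "i \<in> I" for i
    using Disj.prems that by (intro Disj.IH[of _ X _ _ n]) auto
  then show ?case by simp
next
  case (Exists V \<phi>)
  have sub: "chain_sub voc (A i) (A k)" if "i \<le> k" for i k
    using elem[OF that] by (simp add: chain_elem_sub_def)
  have card: "|X \<union> V| <o \<kappa>"
    using Exists.prems assms(1,2) by (auto intro: card_of_Un_ordLess_infinite_Field)
  have transfer: "csat (A k) \<phi> (override_on s a V) \<longleftrightarrow> csat (chain_union A) \<phi> (override_on s a V)"
    if "s ` X \<subseteq> level (A k) p" "a ` V \<subseteq> level (A k) q" for k p q a
  proof (rule Exists.IH[OF card])
    have "level (A k) p \<subseteq> level (A k) (max p q)" "level (A k) q \<subseteq> level (A k) (max p q)"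
      using level_mono[OF cm] by simp_all
    with that show "override_on s a V ` (X \<union> V) \<subseteq> level (A k) (max p q)"
      by (auto simp: override_on_def)
  qed (use Exists.prems in auto)
  show ?case
  proof
    assume "csat (A m) (Exists V \<phi>) s"
    then obtain q a where a: "a ` V \<subseteq> level (A m) q" and sat: "csat (A m) \<phi> (override_on s a V)"
      by auto
    obtain r where "level (A m) q \<subseteq> level (chain_union A) r"
      using chain_sub_chain_union[where A = A and m = m, OF cm sub] unfolding chain_sub_def by blast
    with a sat transfer[OF Exists.prems(2) a] show "csat (chain_union A) (Exists V \<phi>) s"
      by (auto intro!: exI[of _ r] exI[of _ a])
  next
    assume "csat (chain_union A) (Exists V \<phi>) s"
    then obtain r a where a: "a ` V \<subseteq> level (chain_union A) r"
      and sat: "csat (chain_union A) \<phi> (override_on s a V)"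
      by auto
    define k where "k = max m r"
    obtain q where "level (chain_union A) r \<subseteq> level (A k) q"
      using union_level_bounded_in_stage[of voc A r k] cm sub by (auto simp: k_def)
    with a have q: "a ` V \<subseteq> level (A k) q"
      by blast
    obtain p where "level (A m) n \<subseteq> level (A k) p"
      using sub[of m k] unfolding k_def chain_sub_def by auto
    with Exists.prems have p: "s ` X \<subseteq> level (A k) p"
      by blast
    have "csat (A k) (Exists V \<phi>) s"
      using transfer[OF p q] sat q by auto
    \<comment> \<open>The witnesses need not lie in \<open>A m\<close>; only the quantified formula is brought back.\<close>
    moreover have "chain_elem_sub \<kappa> voc (A m) (A k)"
      by (rule elem) (simp add: k_def)
    ultimately show "csat (A m) (Exists V \<phi>) s"
      using Exists.prems unfolding chain_elem_sub_def by blast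
  qed
qed auto

theorem theorem7p18:
  fixes \<kappa> :: "'k rel"
    and voc :: "'r \<rightharpoonup> nat"
    and A :: "nat \<Rightarrow> ('a, 'r) chain_model"
  assumes "singular_card \<kappa>"
    and "has_cofinality \<kappa> natLeq"
    and "\<And>m. is_chain_model voc (A m)"
    and "\<And>m. chain_elem_sub \<kappa> voc (A m) (A (Suc m))"
  shows "\<forall>m. chain_elem_sub \<kappa> voc (A m) (chain_union A)"
proof
  fix m
  have elem: "chain_elem_sub \<kappa> voc (A i) (A k)" if "i \<le> k" for i k
    using assms(3,4) that by (rule chain_elem_sub_le[where A = A])
  have "chain_sub voc (A m) (chain_union A)"
    using chain_sub_chain_union[of voc A m] assms(3) elem by (simp add: chain_elem_sub_def)
  moreover have "Card_order \<kappa>" "infinite (Field \<kappa>)"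
    using assms(1) by (simp_all add: singular_card_def)
  moreover have "csat (A m) \<phi> s \<longleftrightarrow> csat (chain_union A) \<phi> s"
    if "Card_order \<kappa>" "infinite (Field \<kappa>)"
      "|X| <o \<kappa>" "s ` X \<subseteq> level (A m) n" "is_formula \<kappa> voc \<phi>" "free_vars \<phi> \<subseteq> X" for X s \<phi> n
    using that(1,2) assms(3) elem that(3-) by (rule csat_chain_union_iff[where A = A])
  ultimately show "chain_elem_sub \<kappa> voc (A m) (chain_union A)"
    unfolding chain_elem_sub_def by blast
qed

end
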